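(* Let $r\in\mathcal K$, where $\mathcal K$ is the ring of Colombeau generalized numbers. The following are equivalent: (i) $r$ is not invertible in $\mathcal K$. (ii) $r$ is a zero divisor in $\mathcal K$, i.e. there exists $s\in\mathcal K$, $s\neq0$, with $rs=0$.
   Context: Let $\mathbb K=\mathbb R$ or $\mathbb C$. The ring $\mathcal K$ of generalized numbers is the quotient of the ring of moderate nets $(r_\varepsilon)_{\varepsilon\in(0,1]}\in\mathbb K^{(0,1]}$ (those for which there is $N\in\mathbb N$ with $|r_\varepsilon|=O(\varepsilon^{-N})$ as $\varepsilon\to0$) by the ideal of negligible nets (those with $|r_\varepsilon|=O(\varepsilon^m)$ as $\varepsilon\to 0$ for every $m\in\mathbb N$), with $\varepsilon$-wise operations. The element $0$ is counted as a zero divisor. *)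

theory Defs
  imports "HOL-Algebra.QuotRing" "HOL-Library.FuncSet" "HOL-Library.Landau_Symbols"
begin

text \<open>Nets are indexed by \<open>(0,1]\<close>; as HOL functions are total, they are represented by
  extensional functions (\<open>undefined\<close> outside \<open>(0,1]\<close>), so that two nets are equal iff they
  agree on \<open>(0,1]\<close>. The field \<open>'a\<close> is to be instantiated with \<open>real\<close> or \<open>complex\<close>.\<close>

definition moderate_nets :: "(real \<Rightarrow> 'a::real_normed_field) set" where
  "moderate_nets = {r \<in> {0<..1} \<rightarrow>\<^sub>E UNIV.
     \<exists>N::nat. (\<lambda>\<epsilon>. norm (r \<epsilon>)) \<in> O[at_right 0](\<lambda>\<epsilon>. 1 / \<epsilon> ^ N)}"

definition negligible_nets :: "(real \<Rightarrow> 'a::real_normed_field) set" where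
  "negligible_nets = {r \<in> {0<..1} \<rightarrow>\<^sub>E UNIV.
     \<forall>m::nat. (\<lambda>\<epsilon>. norm (r \<epsilon>)) \<in> O[at_right 0](\<lambda>\<epsilon>. \<epsilon> ^ m)}"

definition moderate_ring :: "(real \<Rightarrow> 'a::real_normed_field) ring" where
  "moderate_ring =
     \<lparr>carrier = moderate_nets,
      mult = (\<lambda>r s. \<lambda>\<epsilon>\<in>{0<..1}. r \<epsilon> * s \<epsilon>),
      one = (\<lambda>\<epsilon>\<in>{0<..1}. 1),
      zero = (\<lambda>\<epsilon>\<in>{0<..1}. 0),
      add = (\<lambda>r s. \<lambda>\<epsilon>\<in>{0<..1}. r \<epsilon> + s \<epsilon>)\<rparr>"

definition generalized_numbers :: "(real \<Rightarrow> 'a::real_normed_field) set ring" where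
  "generalized_numbers = moderate_ring Quot negligible_nets"

lemma eventually_unit_interval: "eventually (\<lambda>\<epsilon>::real. \<epsilon> \<in> {0<..1}) (at_right 0)"
  unfolding eventually_at_right_field by (intro exI[of _ 1]) auto

lemma bigo_norm_restrict_iff:
  fixes f :: "real \<Rightarrow> 'a::real_normed_field"
  shows "(\<lambda>\<epsilon>. norm ((\<lambda>\<epsilon>\<in>{0<..1}. f \<epsilon>) \<epsilon>)) \<in> O[at_right 0](g) \<longleftrightarrow>
    (\<lambda>\<epsilon>. norm (f \<epsilon>)) \<in> O[at_right 0](g)"
  by (rule landau_o.big.in_cong)
     (use eventually_unit_interval in \<open>rule eventually_mono, auto\<close>)

lemma bigo_norm_add:
  fixes f g :: "real \<Rightarrow> 'a::real_normed_field"
  assumes "(\<lambda>\<epsilon>. norm (f \<epsilon>)) \<in> O[F](h)" "(\<lambda>\<epsilon>. norm (g \<epsilon>)) \<in> O[F](h)"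
  shows "(\<lambda>\<epsilon>. norm (f \<epsilon> + g \<epsilon>)) \<in> O[F](h)"
proof -
  have "(\<lambda>\<epsilon>. norm (f \<epsilon> + g \<epsilon>)) \<in> O[F](\<lambda>\<epsilon>. norm (f \<epsilon>) + norm (g \<epsilon>))"
    by (intro landau_o.big_mono always_eventually) (auto intro: order_trans[OF norm_triangle_ineq])
  also have "(\<lambda>\<epsilon>. norm (f \<epsilon>) + norm (g \<epsilon>)) \<in> O[F](h)"
    using assms by (rule sum_in_bigo)
  finally show ?thesis .
qed

lemma bigo_inverse_power_mono:
  assumes "M \<le> N"
  shows "(\<lambda>\<epsilon>::real. 1 / \<epsilon> ^ M) \<in> O[at_right 0](\<lambda>\<epsilon>. 1 / \<epsilon> ^ N)"
proof (rule landau_o.big_mono, rule eventually_mono[OF eventually_unit_interval])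
  fix \<epsilon> :: real assume e: "\<epsilon> \<in> {0<..1}"
  then have "\<epsilon> ^ N \<le> \<epsilon> ^ M" using assms by (intro power_decreasing) auto
  then show "norm (1 / \<epsilon> ^ M) \<le> norm (1 / \<epsilon> ^ N)" using e by (auto simp: field_simps)
qed

lemma moderate_add:
  assumes "r \<in> moderate_nets" "s \<in> moderate_nets"
  shows "(\<lambda>\<epsilon>\<in>{0<..1}. r \<epsilon> + s \<epsilon>) \<in> moderate_nets"
proof -
  from assms obtain M N where
    "(\<lambda>\<epsilon>. norm (r \<epsilon>)) \<in> O[at_right 0](\<lambda>\<epsilon>. 1 / \<epsilon> ^ M)"
    "(\<lambda>\<epsilon>. norm (s \<epsilon>)) \<in> O[at_right 0](\<lambda>\<epsilon>. 1 / \<epsilon> ^ N)"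
    by (auto simp: moderate_nets_def)
  then have "(\<lambda>\<epsilon>. norm (r \<epsilon> + s \<epsilon>)) \<in> O[at_right 0](\<lambda>\<epsilon>. 1 / \<epsilon> ^ (max M N))"
    by (intro bigo_norm_add)
       (blast intro: landau_o.big_trans bigo_inverse_power_mono max.cobounded1 max.cobounded2)+
  then show ?thesis
    unfolding moderate_nets_def mem_Collect_eq bigo_norm_restrict_iff by auto
qed

lemma moderate_mult:
  assumes "r \<in> moderate_nets" "s \<in> moderate_nets"
  shows "(\<lambda>\<epsilon>\<in>{0<..1}. r \<epsilon> * s \<epsilon>) \<in> moderate_nets"
proof -
  from assms obtain M N where
    "(\<lambda>\<epsilon>. norm (r \<epsilon>)) \<in> O[at_right 0](\<lambda>\<epsilon>. 1 / \<epsilon> ^ M)"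
    "(\<lambda>\<epsilon>. norm (s \<epsilon>)) \<in> O[at_right 0](\<lambda>\<epsilon>. 1 / \<epsilon> ^ N)"
    by (auto simp: moderate_nets_def)
  from landau_o.big.mult[OF this]
  have "(\<lambda>\<epsilon>. norm (r \<epsilon> * s \<epsilon>)) \<in> O[at_right 0](\<lambda>\<epsilon>. 1 / \<epsilon> ^ (M + N))"
    by (simp add: norm_mult power_add)
  then show ?thesis
    unfolding moderate_nets_def mem_Collect_eq bigo_norm_restrict_iff by auto
qed

lemma moderate_const: "(\<lambda>\<epsilon>\<in>{0<..1}. c) \<in> moderate_nets"
proof -
  have "(\<lambda>\<epsilon>::real. norm c) \<in> O[at_right 0](\<lambda>\<epsilon>. 1 / \<epsilon> ^ 0)" by simp
  then show ?thesis
    unfolding moderate_nets_def mem_Collect_eq bigo_norm_restrict_iff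
    by (intro conjI exI[of _ 0]) auto
qed

lemma moderate_uminus:
  assumes "r \<in> moderate_nets"
  shows "(\<lambda>\<epsilon>\<in>{0<..1}. - r \<epsilon>) \<in> moderate_nets"
  using assms unfolding moderate_nets_def mem_Collect_eq bigo_norm_restrict_iff by simp

lemma moderate_extensional: "r \<in> moderate_nets \<Longrightarrow> r \<in> extensional {0<..1}"
  by (auto simp: moderate_nets_def PiE_def)

lemma cring_moderate_ring: "cring (moderate_ring :: (real \<Rightarrow> 'a::real_normed_field) ring)"
proof (rule cringI)
  show "abelian_group (moderate_ring :: (real \<Rightarrow> 'a) ring)"
  proof (rule abelian_groupI)
    fix x :: "real \<Rightarrow> 'a" assume x: "x \<in> carrier moderate_ring"
    show "\<exists>y\<in>carrier moderate_ring. y \<oplus>\<^bsub>moderate_ring\<^esub> x = \<zero>\<^bsub>moderate_ring\<^esub>"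
      using x by (intro bexI[of _ "\<lambda>\<epsilon>\<in>{0<..1}. - x \<epsilon>"])
        (auto simp: moderate_ring_def moderate_uminus fun_eq_iff)
    show "\<zero>\<^bsub>moderate_ring\<^esub> \<oplus>\<^bsub>moderate_ring\<^esub> x = x"
      using x by (auto simp: moderate_ring_def fun_eq_iff restrict_def
        dest!: moderate_extensional intro: extensional_arb[symmetric])
  qed (auto simp: moderate_ring_def moderate_add moderate_const fun_eq_iff)
  show "comm_monoid (moderate_ring :: (real \<Rightarrow> 'a) ring)"
  proof (rule comm_monoidI)
    fix x :: "real \<Rightarrow> 'a" assume x: "x \<in> carrier moderate_ring"
    show "\<one>\<^bsub>moderate_ring\<^esub> \<otimes>\<^bsub>moderate_ring\<^esub> x = x"
      using x by (auto simp: moderate_ring_def fun_eq_iff restrict_def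
        dest!: moderate_extensional intro: extensional_arb[symmetric])
  qed (auto simp: moderate_ring_def moderate_mult moderate_const fun_eq_iff)
qed (auto simp: moderate_ring_def fun_eq_iff algebra_simps)

lemma negligible_subset_moderate: "negligible_nets \<subseteq> moderate_nets"
proof
  fix r :: "real \<Rightarrow> 'a" assume "r \<in> negligible_nets"
  then have r: "r \<in> {0<..1} \<rightarrow>\<^sub>E UNIV" and
    "(\<lambda>\<epsilon>. norm (r \<epsilon>)) \<in> O[at_right 0](\<lambda>\<epsilon>. \<epsilon> ^ 0)"
    unfolding negligible_nets_def by blast+
  then have "(\<lambda>\<epsilon>. norm (r \<epsilon>)) \<in> O[at_right 0](\<lambda>\<epsilon>. 1 / \<epsilon> ^ 0)" by simp
  with r show "r \<in> moderate_nets" unfolding moderate_nets_def by blast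
qed

lemma negligible_mult:
  assumes "r \<in> negligible_nets" "s \<in> moderate_nets"
  shows "(\<lambda>\<epsilon>\<in>{0<..1}. r \<epsilon> * s \<epsilon>) \<in> negligible_nets"
proof -
  from assms(2) obtain N where
    N: "(\<lambda>\<epsilon>. norm (s \<epsilon>)) \<in> O[at_right 0](\<lambda>\<epsilon>. 1 / \<epsilon> ^ N)"
    by (auto simp: moderate_nets_def)
  have "(\<lambda>\<epsilon>. norm (r \<epsilon> * s \<epsilon>)) \<in> O[at_right 0](\<lambda>\<epsilon>. \<epsilon> ^ m)" for m
  proof -
    have "(\<lambda>\<epsilon>. norm (r \<epsilon>)) \<in> O[at_right 0](\<lambda>\<epsilon>. \<epsilon> ^ (m + N))"
      using assms(1) unfolding negligible_nets_def by blast
    from landau_o.big.mult[OF this N]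
    have "(\<lambda>\<epsilon>. norm (r \<epsilon> * s \<epsilon>)) \<in> O[at_right 0](\<lambda>\<epsilon>. \<epsilon> ^ (m + N) * (1 / \<epsilon> ^ N))"
      by (simp add: norm_mult)
    also have "(\<lambda>\<epsilon>::real. \<epsilon> ^ (m + N) * (1 / \<epsilon> ^ N)) \<in> O[at_right 0](\<lambda>\<epsilon>. \<epsilon> ^ m)"
      by (rule landau_o.big_mono, rule eventually_mono[OF eventually_unit_interval])
         (auto simp: power_add)
    finally show ?thesis .
  qed
  then show ?thesis
    unfolding negligible_nets_def mem_Collect_eq bigo_norm_restrict_iff by auto
qed

lemma negligible_add:
  assumes "r \<in> negligible_nets" "s \<in> negligible_nets"
  shows "(\<lambda>\<epsilon>\<in>{0<..1}. r \<epsilon> + s \<epsilon>) \<in> negligible_nets"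
  using assms unfolding negligible_nets_def mem_Collect_eq bigo_norm_restrict_iff
  by (auto intro: bigo_norm_add)

lemma ideal_negligible_nets:
  "ideal negligible_nets (moderate_ring :: (real \<Rightarrow> 'a::real_normed_field) ring)"
proof -
  interpret R: cring "moderate_ring :: (real \<Rightarrow> 'a) ring" by (rule cring_moderate_ring)
  have zero: "\<zero>\<^bsub>moderate_ring\<^esub> \<in> (negligible_nets :: (real \<Rightarrow> 'a) set)"
    unfolding moderate_ring_def negligible_nets_def ring.simps mem_Collect_eq
      bigo_norm_restrict_iff by simp
  have mult: "r \<otimes>\<^bsub>moderate_ring\<^esub> s \<in> negligible_nets"
    if "r \<in> negligible_nets" "s \<in> carrier moderate_ring" for r s :: "real \<Rightarrow> 'a"
    using that by (simp add: moderate_ring_def negligible_mult)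
  have sub: "r \<in> carrier moderate_ring" if "r \<in> negligible_nets" for r :: "real \<Rightarrow> 'a"
    using that negligible_subset_moderate by (auto simp: moderate_ring_def)
  show ?thesis
  proof (rule idealI)
    show "subgroup negligible_nets (add_monoid (moderate_ring :: (real \<Rightarrow> 'a) ring))"
    proof (rule R.add.subgroupI)
      fix a b :: "real \<Rightarrow> 'a" assume a: "a \<in> negligible_nets" and b: "b \<in> negligible_nets"
      have "\<ominus>\<^bsub>moderate_ring\<^esub> a = a \<otimes>\<^bsub>moderate_ring\<^esub> (\<ominus>\<^bsub>moderate_ring\<^esub> \<one>\<^bsub>moderate_ring\<^esub>)"
        using sub[OF a] by (simp add: R.r_minus)
      then show "\<ominus>\<^bsub>moderate_ring\<^esub> a \<in> negligible_nets"
        using mult[OF a, of "\<ominus>\<^bsub>moderate_ring\<^esub> \<one>\<^bsub>moderate_ring\<^esub>"] by simp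
      show "a \<oplus>\<^bsub>moderate_ring\<^esub> b \<in> negligible_nets"
        using a b by (simp add: moderate_ring_def negligible_add)
    qed (use sub zero in auto)
    show "x \<otimes>\<^bsub>moderate_ring\<^esub> a \<in> negligible_nets"
      if "a \<in> negligible_nets" "x \<in> carrier moderate_ring" for a x :: "real \<Rightarrow> 'a"
      using mult[OF that] that sub R.m_comm by metis
  qed (use mult R.ring_axioms in auto)
qed

lemma cring_generalized_numbers:
  "cring (generalized_numbers :: (real \<Rightarrow> 'a::real_normed_field) set ring)"
  unfolding generalized_numbers_def
  by (rule ideal.quotient_is_cring[OF ideal_negligible_nets cring_moderate_ring])

end

theory Submission
  imports Defs
begin

text \<open>Whether the class of a moderate net \<open>r\<close> is invertible depends only on how small \<open>r\<close> gets near
  \<open>0\<close>. If \<open>\<bar>r \<epsilon>\<bar> \<ge> \<epsilon>\<^sup>m\<close> for some \<open>m\<close> and all small \<open>\<epsilon>\<close>, then the pointwise inverse of \<open>r\<close> is again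
  moderate, so \<open>r\<close> is a unit (\<open>unit_if_bounded_below\<close>). Otherwise, for every \<open>m\<close>, the inequality
  \<open>\<bar>r \<epsilon>\<bar> < \<epsilon>\<^sup>m\<close> holds at points arbitrarily close to \<open>0\<close>; choosing one such point \<open>e m\<close> for each \<open>m\<close>,
  with \<open>e m \<longlonglongrightarrow> 0\<close>, gives a set on which \<open>r\<close> decays faster than any power. The characteristic
  function of that set is not negligible, since it equals \<open>1\<close> along a sequence tending to \<open>0\<close>, but
  its product with \<open>r\<close> is negligible (\<open>zero_divisor_if_not_bounded_below\<close>). Hence every non-unit is
  a zero divisor; the converse holds in every commutative ring.\<close>

lemma negligible_if_eventually_zero:
  fixes f :: "real \<Rightarrow> 'a::real_normed_field"
  assumes "eventually (\<lambda>\<epsilon>. f \<epsilon> = 0) (at_right 0)"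
  shows "(\<lambda>\<epsilon>\<in>{0<..1}. f \<epsilon>) \<in> negligible_nets"
proof -
  have "(\<lambda>\<epsilon>. norm (f \<epsilon>)) \<in> O[at_right 0](\<lambda>\<epsilon>. \<epsilon> ^ m)" for m :: nat
    by (rule landau_o.big_mono, rule eventually_mono[OF assms]) auto
  then show ?thesis
    unfolding negligible_nets_def mem_Collect_eq bigo_norm_restrict_iff by auto
qed

lemma carrier_moderate_ring: "carrier moderate_ring = moderate_nets"
  by (simp add: moderate_ring_def)

lemma coset_in_generalized_numbers:
  "u \<in> moderate_nets \<Longrightarrow>
    negligible_nets +>\<^bsub>moderate_ring\<^esub> u \<in> carrier generalized_numbers"
  by (auto simp: generalized_numbers_def FactRing_def A_RCOSETS_def' carrier_moderate_ring)

lemma generalized_numbers_cases: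
  fixes r :: "(real \<Rightarrow> 'a::real_normed_field) set"
  assumes "r \<in> carrier generalized_numbers"
  obtains u where "u \<in> moderate_nets" "r = negligible_nets +>\<^bsub>moderate_ring\<^esub> u"
  using assms by (auto simp: generalized_numbers_def FactRing_def A_RCOSETS_def' carrier_moderate_ring)

lemma mult_coset:
  fixes u v :: "real \<Rightarrow> 'a::real_normed_field"
  assumes "u \<in> moderate_nets" "v \<in> moderate_nets"
  shows "(negligible_nets +>\<^bsub>moderate_ring\<^esub> u) \<otimes>\<^bsub>generalized_numbers\<^esub>
      (negligible_nets +>\<^bsub>moderate_ring\<^esub> v) =
    negligible_nets +>\<^bsub>moderate_ring\<^esub> (\<lambda>\<epsilon>\<in>{0<..1}. u \<epsilon> * v \<epsilon>)"
  using ideal.rcoset_mult_add[OF ideal_negligible_nets, of u v] assms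
  by (simp add: generalized_numbers_def FactRing_def moderate_ring_def)

lemma coset_eq_zero_iff:
  fixes u :: "real \<Rightarrow> 'a::real_normed_field"
  assumes "u \<in> moderate_nets"
  shows "negligible_nets +>\<^bsub>moderate_ring\<^esub> u = \<zero>\<^bsub>generalized_numbers\<^esub> \<longleftrightarrow> u \<in> negligible_nets"
proof -
  interpret ideal negligible_nets "moderate_ring :: (real \<Rightarrow> 'a) ring"
    by (rule ideal_negligible_nets)
  have "u \<in> carrier moderate_ring" using assms by (simp add: carrier_moderate_ring)
  then show ?thesis
    using rcos_const_imp_mem a_rcos_const by (auto simp: generalized_numbers_def FactRing_def)
qed

lemma coset_eq_one:
  fixes u :: "real \<Rightarrow> 'a::real_normed_field"
  assumes u: "u \<in> moderate_nets" and ev: "eventually (\<lambda>\<epsilon>. u \<epsilon> = 1) (at_right 0)"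
  shows "negligible_nets +>\<^bsub>moderate_ring\<^esub> u = \<one>\<^bsub>generalized_numbers\<^esub>"
proof -
  interpret ideal negligible_nets "moderate_ring :: (real \<Rightarrow> 'a) ring"
    by (rule ideal_negligible_nets)
  let ?h = "\<lambda>\<epsilon>\<in>{0<..1}. u \<epsilon> - 1"
  have "?h \<in> negligible_nets"
    by (rule negligible_if_eventually_zero, rule eventually_mono[OF ev]) simp
  moreover have "u = ?h \<oplus>\<^bsub>moderate_ring\<^esub> \<one>\<^bsub>moderate_ring\<^esub>"
    using extensional_arb[OF moderate_extensional[OF u]]
    by (auto simp: moderate_ring_def fun_eq_iff restrict_def)
  ultimately have "u \<in> negligible_nets +>\<^bsub>moderate_ring\<^esub> \<one>\<^bsub>moderate_ring\<^esub>"
    by (auto simp: a_r_coset_def')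
  then have "negligible_nets +>\<^bsub>moderate_ring\<^esub> \<one>\<^bsub>moderate_ring\<^esub> =
      negligible_nets +>\<^bsub>moderate_ring\<^esub> u"
    by (rule a_repr_independence') simp
  then show ?thesis by (simp add: generalized_numbers_def FactRing_def)
qed

text \<open>The bound \<open>\<epsilon>\<^sup>m \<le> \<bar>u \<epsilon>\<bar>\<close> is the moderateness estimate for the pointwise inverse. Where \<open>u\<close>
  vanishes away from \<open>0\<close> the value of the inverse is immaterial, so the convention
  \<open>inverse 0 = 0\<close> does no harm.\<close>
lemma unit_if_bounded_below:
  fixes u :: "real \<Rightarrow> 'a::real_normed_field"
  assumes u: "u \<in> moderate_nets"
    and lower: "eventually (\<lambda>\<epsilon>. \<epsilon> ^ m \<le> norm (u \<epsilon>)) (at_right 0)"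
  shows "negligible_nets +>\<^bsub>moderate_ring\<^esub> u \<in> Units generalized_numbers"
proof -
  interpret K: cring "generalized_numbers :: (real \<Rightarrow> 'a) set ring"
    by (rule cring_generalized_numbers)
  let ?v = "\<lambda>\<epsilon>\<in>{0<..1}. inverse (u \<epsilon>)"
  have ev: "eventually (\<lambda>\<epsilon>. \<epsilon> \<in> {0<..1} \<and> \<epsilon> ^ m \<le> norm (u \<epsilon>)) (at_right 0)"
    using eventually_unit_interval lower by eventually_elim auto
  have "(\<lambda>\<epsilon>. norm (inverse (u \<epsilon>))) \<in> O[at_right 0](\<lambda>\<epsilon>. 1 / \<epsilon> ^ m)"
  proof (rule landau_o.big_mono, rule eventually_mono[OF ev])
    fix \<epsilon> :: real assume e: "\<epsilon> \<in> {0<..1} \<and> \<epsilon> ^ m \<le> norm (u \<epsilon>)"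
    then have "inverse (norm (u \<epsilon>)) \<le> inverse (\<epsilon> ^ m)"
      by (intro le_imp_inverse_le) auto
    with e show "norm (norm (inverse (u \<epsilon>))) \<le> norm (1 / \<epsilon> ^ m)"
      by (simp add: norm_inverse divide_inverse)
  qed
  then have v: "?v \<in> moderate_nets"
    unfolding moderate_nets_def mem_Collect_eq bigo_norm_restrict_iff by auto
  have "eventually (\<lambda>\<epsilon>. (\<lambda>\<epsilon>\<in>{0<..1}. u \<epsilon> * ?v \<epsilon>) \<epsilon> = 1) (at_right 0)"
  proof (rule eventually_mono[OF ev])
    fix \<epsilon> :: real assume e: "\<epsilon> \<in> {0<..1} \<and> \<epsilon> ^ m \<le> norm (u \<epsilon>)"
    then have "0 < \<epsilon> ^ m" by simp
    with e have "0 < norm (u \<epsilon>)" by linarith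
    then have "u \<epsilon> \<noteq> 0" by simp
    with e show "(\<lambda>\<epsilon>\<in>{0<..1}. u \<epsilon> * ?v \<epsilon>) \<epsilon> = 1" by simp
  qed
  from coset_eq_one[OF moderate_mult[OF u v] this]
  have "(negligible_nets +>\<^bsub>moderate_ring\<^esub> u) \<otimes>\<^bsub>generalized_numbers\<^esub>
      (negligible_nets +>\<^bsub>moderate_ring\<^esub> ?v) = \<one>\<^bsub>generalized_numbers\<^esub>"
    by (simp only: mult_coset[OF u v])
  then show ?thesis
    using coset_in_generalized_numbers[OF u] coset_in_generalized_numbers[OF v] K.m_comm
    unfolding Units_def mem_Collect_eq by metis
qed

text \<open>A diagonal choice over the exponents: \<open>e n\<close> is picked below \<open>1 / (n + 1)\<close> with
  \<open>norm (u (e n)) < (e n)\<^sup>n\<close>. For a fixed exponent \<open>m\<close> only the finitely many terms \<open>e n\<close> with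
  \<open>n < m\<close> could violate the bound, and all of them stay away from \<open>0\<close>.\<close>
lemma rapid_decay_along_sequence:
  fixes u :: "real \<Rightarrow> 'a::real_normed_field"
  assumes "\<And>m. \<not> eventually (\<lambda>\<epsilon>. \<epsilon> ^ m \<le> norm (u \<epsilon>)) (at_right 0)"
  obtains e :: "nat \<Rightarrow> real" where
    "\<And>n. e n \<in> {0<..1}" "e \<longlonglongrightarrow> 0"
    "\<And>m. eventually (\<lambda>\<epsilon>. \<epsilon> \<in> range e \<longrightarrow> norm (u \<epsilon>) \<le> \<epsilon> ^ m) (at_right 0)"
proof -
  have "\<exists>\<epsilon>. 0 < \<epsilon> \<and> \<epsilon> < inverse (real (Suc n)) \<and> norm (u \<epsilon>) < \<epsilon> ^ n" for n
  proof (rule ccontr)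
    assume "\<nexists>\<epsilon>. 0 < \<epsilon> \<and> \<epsilon> < inverse (real (Suc n)) \<and> norm (u \<epsilon>) < \<epsilon> ^ n"
    then have "eventually (\<lambda>\<epsilon>. \<epsilon> ^ n \<le> norm (u \<epsilon>)) (at_right 0)"
      unfolding eventually_at_right_field
      by (intro exI[of _ "inverse (real (Suc n))"]) (force simp: not_less simp del: of_nat_Suc)
    with assms show False by blast
  qed
  then obtain e :: "nat \<Rightarrow> real" where pos: "\<And>n. 0 < e n"
    and small: "\<And>n. e n < inverse (real (Suc n))" and decay: "\<And>n. norm (u (e n)) < e n ^ n"
    by metis
  have unit: "e n \<in> {0<..1}" for n
  proof -
    have "inverse (real (Suc n)) \<le> 1" by (simp add: inverse_le_1_iff)
    with pos[of n] small[of n] show ?thesis by simp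
  qed
  have lim: "e \<longlonglongrightarrow> 0"
    by (rule tendsto_sandwich[OF _ _ tendsto_const LIMSEQ_inverse_real_of_nat])
      (auto intro!: always_eventually less_imp_le pos small simp del: of_nat_Suc)
  have "eventually (\<lambda>\<epsilon>. \<epsilon> \<in> range e \<longrightarrow> norm (u \<epsilon>) \<le> \<epsilon> ^ m) (at_right 0)" for m
  proof -
    \<comment> \<open>Including \<open>1\<close> keeps the minimum defined when \<open>m = 0\<close>.\<close>
    define b where "b = Min (insert 1 (e ` {..<m}))"
    have "0 < b" unfolding b_def by (subst Min_gr_iff) (auto simp: pos)
    moreover have "norm (u \<epsilon>) \<le> \<epsilon> ^ m" if "\<epsilon> < b" "\<epsilon> \<in> range e" for \<epsilon>
    proof -
      from that(2) obtain n where n: "\<epsilon> = e n" by blast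
      have "m \<le> n"
      proof (rule ccontr)
        assume "\<not> m \<le> n"
        then have "b \<le> e n" unfolding b_def by (intro Min_le) auto
        with that(1) n show False by simp
      qed
      then have "e n ^ n \<le> e n ^ m" using unit[of n] by (intro power_decreasing) auto
      with decay[of n] n show ?thesis by simp
    qed
    ultimately show ?thesis unfolding eventually_at_right_field by blast
  qed
  with unit lim that show ?thesis by blast
qed

lemma zero_divisor_if_not_bounded_below:
  fixes u :: "real \<Rightarrow> 'a::real_normed_field"
  assumes u: "u \<in> moderate_nets"
    and not_lower: "\<And>m. \<not> eventually (\<lambda>\<epsilon>. \<epsilon> ^ m \<le> norm (u \<epsilon>)) (at_right 0)"
  shows "\<exists>v \<in> moderate_nets. v \<notin> negligible_nets \<and>
    (\<lambda>\<epsilon>\<in>{0<..1}. u \<epsilon> * v \<epsilon>) \<in> negligible_nets"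
proof -
  obtain e :: "nat \<Rightarrow> real" where unit: "\<And>n. e n \<in> {0<..1}" and lim: "e \<longlonglongrightarrow> 0" and
    decay: "\<And>m. eventually (\<lambda>\<epsilon>. \<epsilon> \<in> range e \<longrightarrow> norm (u \<epsilon>) \<le> \<epsilon> ^ m) (at_right 0)"
    using rapid_decay_along_sequence[OF not_lower] by blast
  define v :: "real \<Rightarrow> 'a" where "v = (\<lambda>\<epsilon>\<in>{0<..1}. if \<epsilon> \<in> range e then 1 else 0)"
  have "(\<lambda>\<epsilon>. norm (if \<epsilon> \<in> range e then 1 else 0 :: 'a)) \<in> O[at_right 0](\<lambda>\<epsilon>. 1 / \<epsilon> ^ 0)"
    by (rule landau_o.big_mono) auto
  then have "v \<in> moderate_nets"
    unfolding v_def moderate_nets_def mem_Collect_eq bigo_norm_restrict_iff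
    by (intro conjI exI[of _ 0]) auto
  moreover have "v \<notin> negligible_nets"
  proof
    assume "v \<in> negligible_nets"
    then have "(\<lambda>\<epsilon>. norm (v \<epsilon>)) \<in> O[at_right 0](\<lambda>\<epsilon>. \<epsilon> ^ 1)"
      unfolding negligible_nets_def by blast
    then obtain c where c: "eventually (\<lambda>\<epsilon>. norm (v \<epsilon>) \<le> c * norm \<epsilon>) (at_right 0)"
      by (auto elim!: landau_o.bigE)
    have right: "filterlim e (at_right 0) sequentially"
      by (rule tendsto_imp_filterlim_at_right[OF lim]) (use unit in auto)
    have "eventually (\<lambda>n. 1 \<le> c * norm (e n)) sequentially"
      using filterlim_iff[THEN iffD1, OF right, rule_format, OF c] unit
      by (simp add: v_def)
    moreover have "(\<lambda>n. c * norm (e n)) \<longlonglongrightarrow> 0"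
      using lim by (intro tendsto_mult_right_zero tendsto_norm_zero)
    ultimately have "(1::real) \<le> 0"
      by (intro tendsto_lowerbound[of _ 0 sequentially]) auto
    then show False by simp
  qed
  moreover have "(\<lambda>\<epsilon>\<in>{0<..1}. u \<epsilon> * v \<epsilon>) \<in> negligible_nets"
  proof -
    have "(\<lambda>\<epsilon>. norm (u \<epsilon> * v \<epsilon>)) \<in> O[at_right 0](\<lambda>\<epsilon>. \<epsilon> ^ m)" for m
    proof (rule landau_o.big_mono)
      show "eventually (\<lambda>\<epsilon>. norm (norm (u \<epsilon> * v \<epsilon>)) \<le> norm (\<epsilon> ^ m)) (at_right 0)"
        using eventually_unit_interval decay[of m]
        by eventually_elim (auto simp: v_def norm_mult)
    qed
    then show ?thesis
      unfolding negligible_nets_def mem_Collect_eq bigo_norm_restrict_iff by auto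
  qed
  ultimately show ?thesis by blast
qed

lemma not_unit_iff_zero_divisor:
  fixes r :: "(real \<Rightarrow> 'a::real_normed_field) set"
  assumes r: "r \<in> carrier generalized_numbers"
  shows "r \<notin> Units generalized_numbers \<longleftrightarrow>
    (\<exists>s \<in> carrier generalized_numbers. s \<noteq> \<zero>\<^bsub>generalized_numbers\<^esub> \<and>
      r \<otimes>\<^bsub>generalized_numbers\<^esub> s = \<zero>\<^bsub>generalized_numbers\<^esub>)"
proof
  assume not_unit: "r \<notin> Units generalized_numbers"
  obtain u where u: "u \<in> moderate_nets" and ru: "r = negligible_nets +>\<^bsub>moderate_ring\<^esub> u"
    using r by (rule generalized_numbers_cases)
  have "\<not> eventually (\<lambda>\<epsilon>. \<epsilon> ^ m \<le> norm (u \<epsilon>)) (at_right 0)" for m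
    using unit_if_bounded_below[OF u, of m] not_unit ru by blast
  then obtain v where v: "v \<in> moderate_nets" "v \<notin> negligible_nets"
    "(\<lambda>\<epsilon>\<in>{0<..1}. u \<epsilon> * v \<epsilon>) \<in> negligible_nets"
    using zero_divisor_if_not_bounded_below[OF u] by blast
  let ?s = "negligible_nets +>\<^bsub>moderate_ring\<^esub> v"
  have "?s \<noteq> \<zero>\<^bsub>generalized_numbers\<^esub>" using v by (simp add: coset_eq_zero_iff)
  moreover have "r \<otimes>\<^bsub>generalized_numbers\<^esub> ?s = \<zero>\<^bsub>generalized_numbers\<^esub>"
    unfolding ru mult_coset[OF u v(1)] coset_eq_zero_iff[OF moderate_mult[OF u v(1)]]
    by (rule v(3))
  ultimately show "\<exists>s \<in> carrier generalized_numbers. s \<noteq> \<zero>\<^bsub>generalized_numbers\<^esub> \<and>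
      r \<otimes>\<^bsub>generalized_numbers\<^esub> s = \<zero>\<^bsub>generalized_numbers\<^esub>"
    using coset_in_generalized_numbers[OF v(1)] by blast
next
  interpret K: cring "generalized_numbers :: (real \<Rightarrow> 'a) set ring"
    by (rule cring_generalized_numbers)
  assume "\<exists>s \<in> carrier generalized_numbers. s \<noteq> \<zero>\<^bsub>generalized_numbers\<^esub> \<and>
      r \<otimes>\<^bsub>generalized_numbers\<^esub> s = \<zero>\<^bsub>generalized_numbers\<^esub>"
  then show "r \<notin> Units generalized_numbers"
    using r K.Units_l_cancel[of r _ "\<zero>\<^bsub>generalized_numbers\<^esub>"] K.r_null K.zero_closed by metis
qed

theorem proposition2p2:
  shows "(\<forall>r \<in> carrier (generalized_numbers :: (real \<Rightarrow> real) set ring).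
            r \<notin> Units generalized_numbers \<longleftrightarrow>
            (\<exists>s \<in> carrier generalized_numbers.
               s \<noteq> \<zero>\<^bsub>generalized_numbers\<^esub> \<and>
               r \<otimes>\<^bsub>generalized_numbers\<^esub> s = \<zero>\<^bsub>generalized_numbers\<^esub>)) \<and>
         (\<forall>r \<in> carrier (generalized_numbers :: (real \<Rightarrow> complex) set ring).
            r \<notin> Units generalized_numbers \<longleftrightarrow>
            (\<exists>s \<in> carrier generalized_numbers.
               s \<noteq> \<zero>\<^bsub>generalized_numbers\<^esub> \<and>
               r \<otimes>\<^bsub>generalized_numbers\<^esub> s = \<zero>\<^bsub>generalized_numbers\<^esub>))"
  by (intro conjI ballI not_unit_iff_zero_divisor)

end
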